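(* Let $p,q$ be complex numbers. The generating function of the odd-indexed $(p,q)$-Lucas numbers is, as a formal power series in $z$, $$\sum_{n=0}^{\infty}L_{p,q,2n+1}z^n=\frac{p+pqz}{1-(p^2+2q)z+q^2z^2}.$$
   Context: The $(p,q)$-Lucas numbers are defined by $L_{p,q,0}=2$, $L_{p,q,1}=p$, and $L_{p,q,n}=pL_{p,q,n-1}+qL_{p,q,n-2}$ for $n\ge 2$. *)

theory Defs
  imports "HOL-Computational_Algebra.Formal_Power_Series" Complex_Main
begin

fun pq_lucas :: "complex \<Rightarrow> complex \<Rightarrow> nat \<Rightarrow> complex" where
  "pq_lucas p q 0 = 2"
| "pq_lucas p q (Suc 0) = p"
| "pq_lucas p q (Suc (Suc n)) = p * pq_lucas p q (Suc n) + q * pq_lucas p q n"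

end

theory Submission
  imports Defs
begin

text \<open>If a, b are the roots of x^2 - p x - q, then a^2 + b^2 = p^2 + 2q and a^2 b^2 = q^2, so
  every second term obeys the recurrence in \<open>pq_lucas_plus_4\<close>, whose coefficients form
  the denominator. Multiplying the series by the denominator thus kills all coefficients from z^2
  on; the two left give the numerator.\<close>

lemma pq_lucas_plus_4:
  "pq_lucas p q (n + 4) = (p\<^sup>2 + 2 * q) * pq_lucas p q (n + 2) - q\<^sup>2 * pq_lucas p q n"
proof -
  have "pq_lucas p q (n + 4) = p * pq_lucas p q (n + 3) + q * pq_lucas p q (n + 2)"
    and "pq_lucas p q (n + 3) = p * pq_lucas p q (n + 2) + q * pq_lucas p q (n + 1)"
    and "pq_lucas p q (n + 2) = p * pq_lucas p q (n + 1) + q * pq_lucas p q n"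
    by (simp_all add: eval_nat_numeral)
  \<comment> \<open>Eliminate the terms at \<open>n + 3\<close> and \<open>n + 1\<close>, the latter
    through p L(n+1) = L(n+2) - q L(n).\<close>
  then show ?thesis
    by algebra
qed

theorem theorem7:
  fixes p q :: complex
  shows "Abs_fps (\<lambda>n. pq_lucas p q (2 * n + 1)) =
    (fps_const p + fps_const (p * q) * fps_X) /
    (1 - fps_const (p\<^sup>2 + 2 * q) * fps_X + fps_const (q\<^sup>2) * fps_X\<^sup>2)"
    (is "?A = ?N / ?D")
proof -
  \<comment> \<open>Grouped this way, each product of \<open>?A\<close> with a power of
    \<open>fps_X\<close> is a mere index shift.\<close>
  have "?A * ?D = ?A - fps_const (p\<^sup>2 + 2 * q) * (?A * fps_X) + fps_const (q\<^sup>2) * (?A * fps_X\<^sup>2)"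
    by (simp only: distrib_left right_diff_distrib mult_1_right mult.left_commute)
  also have "\<dots> = ?N"
  proof (rule fps_ext)
    fix n :: nat
    consider "n = 0" | "n = 1" | m where "n = m + 2"
      by (metis One_nat_def add_2_eq_Suc' not0_implies_Suc)
    then show "fps_nth (?A - fps_const (p\<^sup>2 + 2 * q) * (?A * fps_X)
        + fps_const (q\<^sup>2) * (?A * fps_X\<^sup>2)) n = fps_nth ?N n"
    proof cases
      case 1
      then show ?thesis
        by (simp add: fps_X_power_mult_right_nth)
    next
      case 2
      \<comment> \<open>The coefficient of z is L(3) - (p^2 + 2q) L(1), which leaves p q.\<close>
      have "pq_lucas p q 3 = p * (p\<^sup>2 + 2 * q) + p * q"
        by (simp add: eval_nat_numeral algebra_simps)
      with 2 show ?thesis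
        by (simp add: fps_X_power_mult_right_nth)
    next
      case 3
      \<comment> \<open>The three shifted coefficients are the terms at k + 4, k + 2 and k with k =
        2m + 1.\<close>
      have "2 * n + 1 = (2 * m + 1) + 4" "2 * (n - 1) + 1 = (2 * m + 1) + 2" "n - 2 = m"
        using 3 by simp_all
      with 3 show ?thesis
        using pq_lucas_plus_4[of p q "2 * m + 1"]
        by (simp add: fps_X_power_mult_right_nth del: pq_lucas.simps)
    qed
  qed
  finally have "?A * ?D = ?N" .
  \<comment> \<open>Needed to cancel \<open>?D\<close> in the quotient; its constant coefficient is
    1.\<close>
  moreover have "?D \<noteq> 0"
  proof
    assume "?D = 0"
    then have "fps_nth ?D 0 = 0" by (simp only: fps_zero_nth)
    then show False by simp
  qed
  ultimately show ?thesis
    using nonzero_mult_div_cancel_right[of ?D ?A] by argo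
qed

end
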